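(* Let $p,q\in(0,1]$, $p_{s_0},p_{s_1}\in(0,1]$, $C_{0,1},C_{1,0}>0$, and $\eta=\delta_{\max}/\delta\in(0,1]$. Consider the problem of minimizing, over $(x_0,x_1)\in[0,1]^2\setminus\{(0,0)\}$ (where $x_0=p_{\alpha^{s}_0}$, $x_1=p_{\alpha^{s}_1}$ are the sampling probabilities), the average cost of actuation error $$P_E^C(x_0,x_1)=\frac{pq\,\Psi(x_0,x_1)}{(p+q)\Phi(x_0,x_1)}\quad\text{subject to}\quad q x_0+p x_1\le \eta(p+q),$$ where $\Psi(x_0,x_1)=C_{0,1}x_1p_{s_1}(1-x_0p_{s_0})+C_{1,0}x_0p_{s_0}(1-x_1p_{s_1})$ and $\Phi(x_0,x_1)=p\,x_1p_{s_1}(1-x_0p_{s_0})+x_0p_{s_0}\big(q+(1-q)x_1p_{s_1}\big)$. An optimal pair $(x_0^*,x_1^* )$ is obtained as follows. **Case 1: $pC_{1,0}\ge qC_{0,1}$.** Let $\ell_0=\max\{0,\frac{\eta(p+q)-p}{q}\}$, $u_0=\min\{1,\frac{\eta(p+q)}{q}\}$, and let $x_0$ minimize $F(x)/G(x)$ over $x\in[\ell_0,u_0]$, where $F(x)=A_1x^2+A_2x+A_3$, $G(x)=B_1x^2+B_2x+B_3$ with $$A_1=pq^2p_{s_0}p_{s_1}(C_{0,1}+C_{1,0}),$$ $$A_2=pq\big[C_{1,0}\,p\,p_{s_0}(1-\eta p_{s_1})-qC_{0,1}p_{s_1}-q\eta C_{1,0}p_{s_0}p_{s_1}-\eta(p+q)C_{0,1}p_{s_0}p_{s_1}\big],$$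 $$A_3=pq(p+q)\eta C_{0,1}p_{s_1},$$ $$B_1=(p+q)\big[pq\,p_{s_0}p_{s_1}-q(1-q)p_{s_0}p_{s_1}\big],$$ $$B_2=(p+q)\big[pq\,p_{s_0}-pq\,p_{s_1}-\eta p(p+q)p_{s_0}p_{s_1}+\eta(1-q)(p+q)p_{s_0}p_{s_1}\big],$$ $$B_3=\eta p\,p_{s_1}(p+q)^2.$$ Put $x_1=\frac{\eta(p+q)-q x_0}{p}$. If $$x_1\ge\frac{pC_{1,0}-qC_{0,1}}{p_{s_1}\big(pC_{1,0}+(1-q)C_{0,1}\big)},$$ then $(x_0^*,x_1^* )=(x_0,x_1)$ is optimal; otherwise $(x_0^*,x_1^* )=\big(0,\min\{1,\tfrac{\eta(p+q)}{p}\}\big)$ is optimal. Moreover, with $\Delta=(2A_1B_3-2A_3B_1)^2-4(A_1B_2-A_2B_1)(A_2B_3-A_3B_2)$: if $\Delta\ge0$, the minimum of $F/G$ on $[\ell_0,u_0]$ is attained at one of $\ell_0$, $u_0$, or those of the critical points $$x=\frac{2(A_3B_1-A_1B_3)\pm\sqrt{\Delta}}{2(A_1B_2-A_2B_1)}\ \ (\text{if }A_1B_2\ne A_2B_1),\qquad x=\frac{A_3B_2-A_2B_3}{2(A_1B_3-A_3B_1)}\ \ (\text{if }A_1B_2=A_2B_1,\ A_1B_3\neq A_3B_1)$$ that lie in $[\ell_0,u_0]$; if $\Delta<0$, it is attained at $\ell_0$ when $A_1B_2>A_2B_1$ and at $u_0$ when $A_1B_2<A_2B_1$. **Case 2: $pC_{1,0}<qC_{0,1}$.**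 Let $\ell_1=\max\{0,\frac{\eta(p+q)-q}{p}\}$, $u_1=\min\{1,\frac{\eta(p+q)}{p}\}$, and let $x_1$ minimize $H(x)/K(x)$ over $x\in[\ell_1,u_1]$, where $$H(x)=pq\big[C_{1,0}p_{s_0}(1-xp_{s_1})\big(px-\eta(p+q)\big)-C_{0,1}xp_{s_1}\big(q+pxp_{s_0}-\eta p_{s_0}(p+q)\big)\big],$$ $$K(x)=(p+q)\big[\eta p_{s_0}(p+q)\big(xp_{s_1}(p+q-1)-q\big)-px\big(q(p_{s_1}-p_{s_0})+p_{s_0}xp_{s_1}(p+q-1)\big)\big].$$ Put $x_0=\frac{\eta(p+q)-p x_1}{q}$. If $$x_0\ge\frac{qC_{0,1}-pC_{1,0}}{p_{s_0}\big(qC_{0,1}+(1-p)C_{1,0}\big)},$$ then $(x_0^*,x_1^* )=(x_0,x_1)$ is optimal; otherwise $(x_0^*,x_1^* )=\big(\min\{1,\tfrac{\eta(p+q)}{q}\},0\big)$ is optimal.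
   Context: Origin of the problem. The source $X(t)$ is a Markov chain on $\{0,1\}$ with $\Pr[X(t+1)=1\mid X(t)=0]=p$ and $\Pr[X(t+1)=0\mid X(t)=1]=q$. Under the state-aware randomized stationary policy, when the source is in state $i$ it is sampled and the sample transmitted with probability $x_i=p_{\alpha^{s}_i}$, and a transmission then succeeds with probability $p_{s_i}$ (all independently); the reconstruction $\hat X$ equals the latest successfully received sample. $C_{i,j}$ is the cost of error when the source is in state $i$ and the reconstruction in state $j\ne i$. The average cost of actuation error is $P_E^C=C_{0,1}\pi_{0,1}+C_{1,0}\pi_{1,0}$, with $\pi_{i,j}$ the stationary probability of $X(t)=i,\hat X(t)=j$; it has the explicit form given in the claim. Each sampling attempt costs $\delta>0$ and the time-averaged sampling cost, which equals $\delta\,\frac{q x_0+p x_1}{p+q}$, must not exceed $\delta_{\max}$; with $\eta=\delta_{\max}/\delta$ this is the constraint $qx_0+px_1\le\eta(p+q)$. "Optimal" means feasible and attaining the minimum of $P_E^C$ over all feasible pairs. The point $(0,0)$ is excluded because $\Phi(0,0)=0$, so $P_E^C$ is undefined there. *)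

theory Defs
  imports Complex_Main
begin

text \<open>
  Throughout, \<open>ps0, ps1\<close> are the success probabilities of a transmission in source state
  0 and 1, and \<open>C01\<close> (\<open>C10\<close>) is the cost of source state 0 (1) with reconstruction 1 (0).
\<close>

definition Psi :: "real \<Rightarrow> real \<Rightarrow> real \<Rightarrow> real \<Rightarrow> real \<Rightarrow> real \<Rightarrow> real" where
  "Psi ps0 ps1 C01 C10 x0 x1 =
     C01 * x1 * ps1 * (1 - x0 * ps0) + C10 * x0 * ps0 * (1 - x1 * ps1)"

definition Phi :: "real \<Rightarrow> real \<Rightarrow> real \<Rightarrow> real \<Rightarrow> real \<Rightarrow> real \<Rightarrow> real" where
  "Phi p q ps0 ps1 x0 x1 =
     p * x1 * ps1 * (1 - x0 * ps0) + x0 * ps0 * (q + (1 - q) * x1 * ps1)"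

text \<open>
  Average cost of actuation error. For admissible parameters \<open>Phi\<close> vanishes on the unit square
  only at \<open>(0, 0)\<close>; that point is excluded in \<open>feasible\<close>, so the value \<open>x / 0 = 0\<close> plays no role.
\<close>

definition PEC :: "real \<Rightarrow> real \<Rightarrow> real \<Rightarrow> real \<Rightarrow> real \<Rightarrow> real \<Rightarrow> real \<Rightarrow> real \<Rightarrow> real" where
  "PEC p q ps0 ps1 C01 C10 x0 x1 =
     p * q * Psi ps0 ps1 C01 C10 x0 x1 / ((p + q) * Phi p q ps0 ps1 x0 x1)"

definition feasible :: "real \<Rightarrow> real \<Rightarrow> real \<Rightarrow> (real \<times> real) set" where
  "feasible p q eta =
     {(x0, x1). x0 \<in> {0..1} \<and> x1 \<in> {0..1} \<and> (x0, x1) \<noteq> (0, 0) \<and>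
                q * x0 + p * x1 \<le> eta * (p + q)}"

definition optimal ::
  "real \<Rightarrow> real \<Rightarrow> real \<Rightarrow> real \<Rightarrow> real \<Rightarrow> real \<Rightarrow> real \<Rightarrow> real \<times> real \<Rightarrow> bool" where
  "optimal p q ps0 ps1 C01 C10 eta z \<longleftrightarrow>
     is_arg_min (\<lambda>(x0, x1). PEC p q ps0 ps1 C01 C10 x0 x1) (\<lambda>y. y \<in> feasible p q eta) z"

abbreviation minimizes_on :: "(real \<Rightarrow> real) \<Rightarrow> real set \<Rightarrow> real \<Rightarrow> bool" where
  "minimizes_on f S x \<equiv> is_arg_min f (\<lambda>y. y \<in> S) x"

end

theory Submission
  imports Defs
begin

text \<open>
  Off the axes, writing \<open>a = x0 * ps0\<close>, \<open>b = x1 * ps1\<close>, \<open>U = 1/a - 1\<close> and \<open>V = 1/b - 1\<close>, the cost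
  is a constant multiple of the linear fractional function
  \<open>(C01 * U + C10 * V) / (p * U + q * V + 1)\<close>, which is monotone in each variable separately. If \<open>p * C10 \<ge> q * C01\<close> it always decreases in \<open>x1\<close>, whereas in
  \<open>x0\<close> it decreases for \<open>x1\<close> above the threshold and increases below it. On the axis \<open>x0 = 0\<close> it is
  constant, and that constant separates the values above the threshold from those below. A feasible
  point above the threshold is improved by moving up to the boundary of the budget constraint,
  where the cost is \<open>F/G\<close>; below the threshold the axis is better. Case 2 is Case 1 with the
  two source states exchanged.
\<close>

section \<open>Minimizers on a set and on a compact interval\<close>

lemma minimizes_on_iff: "minimizes_on f S x \<longleftrightarrow> x \<in> S \<and> (\<forall>y\<in>S. f x \<le> f y)"
  by (auto simp: is_arg_min_def not_less)

lemma minimizes_on_exists: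
  fixes f :: "real \<Rightarrow> real"
  assumes "l \<le> u" and "continuous_on {l..u} f"
  shows "\<exists>x. minimizes_on f {l..u} x"
  using continuous_attains_inf[of "{l..u}" f] assms unfolding minimizes_on_iff by auto

subsection \<open>Quotients of quadratic functions\<close>

locale quadratic_quotient =
  fixes A1 A2 A3 B1 B2 B3 l u :: real and F G :: "real \<Rightarrow> real"
  assumes F: "F = (\<lambda>x. A1 * x\<^sup>2 + A2 * x + A3)"
    and G: "G = (\<lambda>x. B1 * x\<^sup>2 + B2 * x + B3)"
    and lu: "l \<le> u"
    and G_pos: "\<And>x. x \<in> {l..u} \<Longrightarrow> 0 < G x"
begin

text \<open>The numerator \<open>F' * G - F * G'\<close> of the derivative of \<open>F / G\<close>,
  whose cubic terms cancel. On \<open>{l..u}\<close> it carries the sign of that derivative.\<close>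

definition N :: "real \<Rightarrow> real" where
  "N x = (A1 * B2 - A2 * B1) * x\<^sup>2 + 2 * (A1 * B3 - A3 * B1) * x + (A2 * B3 - A3 * B2)"

text \<open>The discriminant of \<open>N\<close>. It is a square when the leading coefficient of
  \<open>N\<close> vanishes, so a negative value forces \<open>N\<close> to be truly
  quadratic.\<close>

definition Delta :: real where
  "Delta = (2 * A1 * B3 - 2 * A3 * B1)\<^sup>2 - 4 * (A1 * B2 - A2 * B1) * (A2 * B3 - A3 * B2)"

lemma deriv_quotient:
  assumes "x \<in> {l..u}"
  shows "((\<lambda>x. F x / G x) has_real_derivative N x / (G x)\<^sup>2) (at x)"
proof -
  have "(F has_real_derivative 2 * A1 * x + A2) (at x)"
    unfolding F by (auto intro!: derivative_eq_intros)
  moreover have "(G has_real_derivative 2 * B1 * x + B2) (at x)"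
    unfolding G by (auto intro!: derivative_eq_intros)
  ultimately have "((\<lambda>x. F x / G x) has_real_derivative
      ((2 * A1 * x + A2) * G x - F x * (2 * B1 * x + B2)) / (G x * G x)) (at x)"
    using G_pos[OF assms] by (intro DERIV_divide) auto
  moreover have "(2 * A1 * x + A2) * G x - F x * (2 * B1 * x + B2) = N x"
    unfolding F G N_def by algebra
  ultimately show ?thesis by (simp add: power2_eq_square)
qed

lemma continuous_quotient: "continuous_on {l..u} (\<lambda>x. F x / G x)"
  using deriv_quotient by (meson DERIV_isCont continuous_at_imp_continuous_on)

lemma quotient_minimum_exists: "\<exists>x. minimizes_on (\<lambda>x. F x / G x) {l..u} x"
  using minimizes_on_exists lu continuous_quotient .

lemma minimizes_on_lower:
  assumes "\<And>x. x \<in> {l..u} \<Longrightarrow> 0 \<le> N x"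
  shows "minimizes_on (\<lambda>x. F x / G x) {l..u} l"
proof -
  have "F l / G l \<le> F y / G y" if "y \<in> {l..u}" for y
  proof (rule DERIV_nonneg_imp_nondecreasing[where f = "\<lambda>x. F x / G x"])
    show "l \<le> y" using that by simp
    show "\<exists>d. ((\<lambda>x. F x / G x) has_real_derivative d) (at x) \<and> 0 \<le> d" if "l \<le> x" "x \<le> y" for x
      using deriv_quotient[of x] assms[of x] that \<open>y \<in> {l..u}\<close> by (intro exI[of _ "N x / (G x)\<^sup>2"]) auto
  qed
  with lu show ?thesis unfolding minimizes_on_iff by auto
qed

lemma minimizes_on_upper:
  assumes "\<And>x. x \<in> {l..u} \<Longrightarrow> N x \<le> 0"
  shows "minimizes_on (\<lambda>x. F x / G x) {l..u} u"
proof -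
  have "F u / G u \<le> F y / G y" if "y \<in> {l..u}" for y
  proof (rule DERIV_nonpos_imp_nonincreasing[where f = "\<lambda>x. F x / G x"])
    show "y \<le> u" using that by simp
    show "\<exists>d. ((\<lambda>x. F x / G x) has_real_derivative d) (at x) \<and> d \<le> 0" if "y \<le> x" "x \<le> u" for x
      using deriv_quotient[of x] assms[of x] that \<open>y \<in> {l..u}\<close>
      by (intro exI[of _ "N x / (G x)\<^sup>2"]) (auto simp: divide_le_0_iff)
  qed
  with lu show ?thesis unfolding minimizes_on_iff by auto
qed

text \<open>Completing the square. It serves both discriminant cases: a negative
  \<open>Delta\<close> makes the right side positive, and a zero of \<open>N\<close> makes the
  square equal to \<open>Delta\<close>.\<close>

lemma four_lead_N:
  "4 * (A1 * B2 - A2 * B1) * N x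
     = (2 * (A1 * B2 - A2 * B1) * x + 2 * (A1 * B3 - A3 * B1))\<^sup>2 - Delta"
  unfolding N_def Delta_def by algebra

text \<open>\<open>N\<close> keeps the sign of its leading coefficient everywhere, so
  \<open>F / G\<close> is monotone on the whole interval.\<close>

lemma minimum_negative_discriminant:
  assumes "Delta < 0"
  shows "A1 * B2 > A2 * B1 \<Longrightarrow> minimizes_on (\<lambda>x. F x / G x) {l..u} l"
    and "A1 * B2 < A2 * B1 \<Longrightarrow> minimizes_on (\<lambda>x. F x / G x) {l..u} u"
proof -
  have pos: "0 < (A1 * B2 - A2 * B1) * N x" for x
    using four_lead_N[of x] assms
      zero_le_power2[of "2 * (A1 * B2 - A2 * B1) * x + 2 * (A1 * B3 - A3 * B1)"] by linarith
  show "minimizes_on (\<lambda>x. F x / G x) {l..u} l" if "A1 * B2 > A2 * B1"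
    using pos that by (intro minimizes_on_lower) (auto simp: zero_less_mult_iff less_imp_le)
  show "minimizes_on (\<lambda>x. F x / G x) {l..u} u" if "A1 * B2 < A2 * B1"
    using pos that by (intro minimizes_on_upper) (auto simp: zero_less_mult_iff less_imp_le)
qed

lemma interior_minimum_critical:
  assumes "minimizes_on (\<lambda>x. F x / G x) {l..u} x" and "l < x" and "x < u"
  shows "N x = 0"
proof -
  have "N x / (G x)\<^sup>2 = 0"
  proof (rule DERIV_local_min)
    show "((\<lambda>x. F x / G x) has_real_derivative N x / (G x)\<^sup>2) (at x)"
      using assms by (intro deriv_quotient) auto
    \<comment> \<open>The largest radius around \<open>x\<close> whose open neighbourhood stays
      inside \<open>{l..u}\<close>.\<close>
    show "0 < min (x - l) (u - x)" using assms by simp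
    show "\<forall>y. \<bar>x - y\<bar> < min (x - l) (u - x) \<longrightarrow> F x / G x \<le> F y / G y"
      using assms(1) unfolding minimizes_on_iff by (auto simp: abs_less_iff)
  qed
  moreover have "0 < G x" using assms by (intro G_pos) auto
  ultimately show ?thesis by simp
qed

text \<open>A minimizer off the endpoints is a zero of \<open>N\<close>; the formula for it depends
  on the degree of \<open>N\<close>.\<close>

lemma minimum_nonneg_discriminant:
  assumes "0 \<le> Delta"
  shows "\<exists>x. minimizes_on (\<lambda>x. F x / G x) {l..u} x \<and>
    (x = l \<or> x = u \<or>
     x \<in> {l..u} \<and>
     (A1 * B2 \<noteq> A2 * B1 \<and>
        (x = (2 * (A3 * B1 - A1 * B3) + sqrt Delta) / (2 * (A1 * B2 - A2 * B1)) \<or>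
         x = (2 * (A3 * B1 - A1 * B3) - sqrt Delta) / (2 * (A1 * B2 - A2 * B1))) \<or>
      A1 * B2 = A2 * B1 \<and> A1 * B3 \<noteq> A3 * B1 \<and>
        x = (A3 * B2 - A2 * B3) / (2 * (A1 * B3 - A3 * B1))))"
proof -
  obtain x where x: "minimizes_on (\<lambda>x. F x / G x) {l..u} x"
    using quotient_minimum_exists by blast
  then have xin: "x \<in> {l..u}" unfolding minimizes_on_iff by blast
  consider "x = l \<or> x = u" | "l < x" "x < u" using xin by fastforce
  then show ?thesis
  proof cases
    case 1
    with x show ?thesis by blast
  next
    case 2
    have N0: "N x = 0" using interior_minimum_critical x 2 .
    consider (degree2) "A1 * B2 \<noteq> A2 * B1"
      | (degree1) "A1 * B2 = A2 * B1" "A1 * B3 \<noteq> A3 * B1"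
      | (degree0) "A1 * B2 = A2 * B1" "A1 * B3 = A3 * B1" by blast
    then show ?thesis
    proof cases
      case degree2
      \<comment> \<open>\<open>?r\<close> is the derivative of \<open>N\<close> at \<open>x\<close>;
        at a zero of \<open>N\<close> its square is \<open>Delta\<close>.\<close>
      let ?r = "2 * (A1 * B2 - A2 * B1) * x + 2 * (A1 * B3 - A3 * B1)"
      have "?r\<^sup>2 = (sqrt Delta)\<^sup>2"
        using four_lead_N[of x] N0 assms by simp
      then have "?r = sqrt Delta \<or> ?r = - sqrt Delta" by (simp add: power2_eq_iff)
      then have "x = (2 * (A3 * B1 - A1 * B3) + sqrt Delta) / (2 * (A1 * B2 - A2 * B1)) \<or>
         x = (2 * (A3 * B1 - A1 * B3) - sqrt Delta) / (2 * (A1 * B2 - A2 * B1))"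
        using degree2 by (auto simp: field_simps)
      with degree2 x xin show ?thesis by blast
    next
      case degree1
      then have "x = (A3 * B2 - A2 * B3) / (2 * (A1 * B3 - A3 * B1))"
        using N0 unfolding N_def by (simp add: field_simps)
      with degree1 x xin show ?thesis by blast
    next
      case degree0
      \<comment> \<open>Here \<open>N\<close> is identically zero and \<open>F / G\<close> is
        constant. No critical point formula need give \<open>x\<close>, so the endpoint
        \<open>l\<close> replaces it as the witness.\<close>
      then have "N y = 0" for y
        using N0 unfolding N_def by simp
      then have "minimizes_on (\<lambda>x. F x / G x) {l..u} l" by (intro minimizes_on_lower) simp
      then show ?thesis by blast
    qed
  qed
qed

end

subsection \<open>Monotonicity of the cost\<close>

text \<open>Relabelling the two source states; this symmetry carries Case 1 over to Case 2.\<close>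

lemma PEC_swap: "PEC p q ps0 ps1 C01 C10 x0 x1 = PEC q p ps1 ps0 C10 C01 x1 x0"
proof -
  have "Psi ps0 ps1 C01 C10 x0 x1 = Psi ps1 ps0 C10 C01 x1 x0"
    unfolding Psi_def by algebra
  moreover have "Phi p q ps0 ps1 x0 x1 = Phi q p ps1 ps0 x1 x0"
    unfolding Phi_def by algebra
  ultimately show ?thesis unfolding PEC_def by (simp add: ac_simps)
qed

lemma optimal_swap:
  "optimal p q ps0 ps1 C01 C10 eta (x0, x1) \<longleftrightarrow> optimal q p ps1 ps0 C10 C01 eta (x1, x0)"
  unfolding optimal_def is_arg_min_def feasible_def PEC_swap[of p]
  by (auto simp: add.commute)

locale status_source =
  fixes p q ps0 ps1 C01 C10 :: real
  assumes p: "0 < p" and q: "0 < q"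
    and ps0: "0 < ps0" "ps0 \<le> 1" and ps1: "0 < ps1" "ps1 \<le> 1"
    and C01: "0 < C01" and C10: "0 < C10"
begin

abbreviation "cost \<equiv> PEC p q ps0 ps1 C01 C10"
abbreviation "Phi' \<equiv> Phi p q ps0 ps1"
abbreviation "Psi' \<equiv> Psi ps0 ps1 C01 C10"

lemma Phi_pos:
  assumes "x0 \<in> {0..1}" "x1 \<in> {0..1}" "(x0, x1) \<noteq> (0, 0)"
  shows "0 < Phi' x0 x1"
proof -
  define a b where "a = x0 * ps0" and "b = x1 * ps1"
  have ab: "0 \<le> a" "a \<le> 1" "0 \<le> b" "b \<le> 1" "0 < a \<or> 0 < b"
    using assms ps0 ps1 by (auto simp: a_def b_def mult_le_one)
  \<comment> \<open>Each summand is nonnegative, and all three vanish together only for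
    \<open>a = b = 0\<close>.\<close>
  have eq: "Phi' x0 x1 = p * (b * (1 - a)) + q * (a * (1 - b)) + a * b"
    unfolding Phi_def a_def b_def by algebra
  have "0 \<le> b * (1 - a)" "0 \<le> a * (1 - b)" "0 \<le> a * b" using ab by auto
  moreover have "b * (1 - a) \<noteq> 0 \<or> a * (1 - b) \<noteq> 0 \<or> a * b \<noteq> 0" using ab by auto
  ultimately show ?thesis
    using p q unfolding eq by (smt (verit) mult_pos_pos mult_nonneg_nonneg)
qed

lemma cost_eq: "cost x0 x1 = p * q / (p + q) * (Psi' x0 x1 / Phi' x0 x1)"
  unfolding PEC_def by simp

text \<open>Reduces every comparison of costs to the sign of a polynomial, which the later lemmas
  factor.\<close>

lemma cost_le_cost_iff:
  assumes "0 < Phi' x0 x1" "0 < Phi' y0 y1"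
  shows "cost x0 x1 \<le> cost y0 y1 \<longleftrightarrow> Psi' x0 x1 * Phi' y0 y1 \<le> Psi' y0 y1 * Phi' x0 x1"
proof -
  have "cost x0 x1 \<le> cost y0 y1 \<longleftrightarrow> Psi' x0 x1 / Phi' x0 x1 \<le> Psi' y0 y1 / Phi' y0 y1"
    unfolding cost_eq using p q by (intro mult_le_cancel_left_pos) simp
  also have "\<dots> \<longleftrightarrow> Psi' x0 x1 * Phi' y0 y1 \<le> Psi' y0 y1 * Phi' x0 x1"
    using assms by (simp add: field_simps)
  finally show ?thesis .
qed

end

section \<open>Case 1: the threshold and the resulting comparisons\<close>

locale status_source_case1 = status_source +
  fixes eta :: real
  assumes p1: "p \<le> 1" and q1: "q \<le> 1"
    and eta: "0 < eta" "eta \<le> 1"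
    and case1: "q * C01 \<le> p * C10"
begin

text \<open>The height \<open>x1\<close> at which the factor
  \<open>p * C10 - q * C01 - x1 * ps1 * (p * C10 + (1 - q) * C01)\<close> changes sign. This factor
  governs both the comparison with the axis and the dependence on \<open>x0\<close>. The threshold
  may exceed 1.\<close>

definition threshold :: real where
  "threshold = (p * C10 - q * C01) / (ps1 * (p * C10 + (1 - q) * C01))"

lemma threshold_le_iff: "threshold \<le> x \<longleftrightarrow> p * C10 - q * C01 \<le> x * ps1 * (p * C10 + (1 - q) * C01)"
proof -
  have "0 < ps1 * (p * C10 + (1 - q) * C01)"
    using p ps1 C01 C10 q1 by (intro mult_pos_pos add_pos_nonneg) auto
  then show ?thesis unfolding threshold_def by (simp add: pos_divide_le_eq mult.assoc)
qed

lemma cost_axis: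
  assumes "0 < x1"
  shows "cost 0 x1 = q * C01 / (p + q)"
  using assms p q ps1 by (simp add: PEC_def Psi_def Phi_def)

lemma
  assumes x: "x0 \<in> {0..1}" "x1 \<in> {0..1}" "(x0, x1) \<noteq> (0, 0)"
  shows cost_above_threshold: "threshold \<le> x1 \<Longrightarrow> cost x0 x1 \<le> q * C01 / (p + q)"
    and cost_below_threshold: "x1 < threshold \<Longrightarrow> q * C01 / (p + q) \<le> cost x0 x1"
proof -
  \<comment> \<open>The point \<open>(0, 1)\<close> represents the axis, where the cost is constant
    for positive \<open>x1\<close>. It is only a reference value and need not satisfy the budget
    constraint.\<close>
  have pos: "0 < Phi' x0 x1" "0 < Phi' 0 1" using Phi_pos x by auto
  have eq: "Psi' x0 x1 * Phi' 0 1 - Psi' 0 1 * Phi' x0 x1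
      = x0 * ps0 * ps1 * (p * C10 - q * C01 - x1 * ps1 * (p * C10 + (1 - q) * C01))"
    unfolding Psi_def Phi_def by algebra
  have ax: "cost 0 1 = q * C01 / (p + q)" by (rule cost_axis) simp
  have "0 \<le> x0 * ps0 * ps1" using x ps0 ps1 by simp
  note sgn = mult_nonneg_nonneg[OF this] mult_nonneg_nonpos[OF this]
  show "cost x0 x1 \<le> q * C01 / (p + q)" if "threshold \<le> x1"
    using sgn(2)[of "p * C10 - q * C01 - x1 * ps1 * (p * C10 + (1 - q) * C01)"] that pos eq
    unfolding ax[symmetric] threshold_le_iff by (simp add: cost_le_cost_iff)
  show "q * C01 / (p + q) \<le> cost x0 x1" if "x1 < threshold"
    using sgn(1)[of "p * C10 - q * C01 - x1 * ps1 * (p * C10 + (1 - q) * C01)"] that pos eq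
    unfolding ax[symmetric] not_le[symmetric] threshold_le_iff by (simp add: cost_le_cost_iff)
qed

lemma cost_antimono_fst:
  assumes "0 \<le> x0" "x0 \<le> y0" "y0 \<le> 1" "x1 \<in> {0..1}" "(x0, x1) \<noteq> (0, 0)" and "threshold \<le> x1"
  shows "cost y0 x1 \<le> cost x0 x1"
proof -
  have "0 < Phi' x0 x1" "0 < Phi' y0 x1" using assms by (auto intro!: Phi_pos)
  moreover have "Psi' y0 x1 * Phi' x0 x1 - Psi' x0 x1 * Phi' y0 x1
      = ps0 * (y0 - x0) * (x1 * ps1)
        * (p * C10 - q * C01 - x1 * ps1 * (p * C10 + (1 - q) * C01))"
    unfolding Psi_def Phi_def by algebra
  moreover have "\<dots> \<le> 0"
    using assms ps0 ps1 threshold_le_iff by (intro mult_nonneg_nonpos mult_nonneg_nonneg) auto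
  ultimately show ?thesis by (simp add: cost_le_cost_iff)
qed

text \<open>The mirror image of the previous factorization; \<open>case1\<close> alone fixes the
  sign of its last factor, so no threshold on \<open>x0\<close> arises.\<close>

lemma cost_antimono_snd:
  assumes "x0 \<in> {0..1}" "0 \<le> x1" "x1 \<le> y1" "y1 \<le> 1" "(x0, x1) \<noteq> (0, 0)"
  shows "cost x0 y1 \<le> cost x0 x1"
proof -
  have "0 < Phi' x0 x1" "0 < Phi' x0 y1" using assms by (auto intro!: Phi_pos)
  moreover have "Psi' x0 y1 * Phi' x0 x1 - Psi' x0 x1 * Phi' x0 y1
      = ps1 * (y1 - x1) * (x0 * ps0)
        * (q * C01 - p * C10 - x0 * ps0 * (q * C01 + (1 - p) * C10))"
    unfolding Psi_def Phi_def by algebra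
  moreover have "\<dots> \<le> 0"
  proof (intro mult_nonneg_nonpos)
    have "0 \<le> x0 * ps0 * (q * C01 + (1 - p) * C10)"
      using assms p1 q ps0 C01 C10 by (intro mult_nonneg_nonneg add_nonneg_nonneg) auto
    with case1 show "q * C01 - p * C10 - x0 * ps0 * (q * C01 + (1 - p) * C10) \<le> 0" by linarith
  qed (use assms ps0 ps1 in auto)
  ultimately show ?thesis by (simp add: cost_le_cost_iff)
qed

subsection \<open>The boundary of the budget constraint\<close>

abbreviation "budget_line x \<equiv> (eta * (p + q) - q * x) / p"

abbreviation "line_segment \<equiv> {max 0 ((eta * (p + q) - p) / q) .. min 1 (eta * (p + q) / q)}"

text \<open>The nontrivial endpoints are the abscissae where the budget line meets
  \<open>x1 = 1\<close> and \<open>x1 = 0\<close>.\<close>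

lemma line_segment_iff: "x \<in> line_segment \<longleftrightarrow> x \<in> {0..1} \<and> budget_line x \<in> {0..1}"
  using p q by (auto simp: field_simps)

lemma budget_line_feasible:
  assumes "x \<in> line_segment"
  shows "(x, budget_line x) \<in> feasible p q eta"
  using assms p q eta unfolding line_segment_iff feasible_def by auto

lemma Phi_line_pos: "x \<in> line_segment \<Longrightarrow> 0 < Phi' x (budget_line x)"
  using budget_line_feasible[of x] by (intro Phi_pos) (auto simp: feasible_def)

text \<open>The budget line separates \<open>(0, 0)\<close> from \<open>(1, 1)\<close>, weakly when
  \<open>eta = 1\<close>, and so meets the unit square.\<close>

lemma line_segment_nonempty:
  "max 0 ((eta * (p + q) - p) / q) \<le> min 1 (eta * (p + q) / q)"
proof -
  have "eta * (p + q) \<le> p + q" using eta p q by (simp add: mult_left_le_one_le)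
  moreover have "0 \<le> eta * (p + q)" using eta p q by simp
  ultimately show ?thesis using p q by (simp add: field_simps)
qed

text \<open>Move right at height \<open>y1\<close>, then up to the budget line. The threshold is
  needed for the first move only.\<close>

lemma line_dominates_above_threshold:
  assumes y: "(y0, y1) \<in> feasible p q eta" and "threshold \<le> y1"
  shows "\<exists>x\<in>line_segment. cost x (budget_line x) \<le> cost y0 y1"
proof
  \<comment> \<open>The abscissa where the horizontal line at height \<open>y1\<close> meets the
    budget line, capped at the side of the square.\<close>
  define z where "z = min 1 ((eta * (p + q) - p * y1) / q)"
  have box: "0 \<le> y0" "y0 \<le> 1" "0 \<le> y1" "y1 \<le> 1" "(y0, y1) \<noteq> (0, 0)"
    and budget: "q * y0 + p * y1 \<le> eta * (p + q)"
    using y by (auto simp: feasible_def)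
  have z: "y0 \<le> z" "z \<le> 1"
    using box budget q by (auto simp: z_def field_simps)
  have "eta * (p + q) \<le> p + q" using eta p q by (simp add: mult_left_le_one_le)
  \<comment> \<open>Without the cap, \<open>budget_line z\<close> is just \<open>y1\<close>; with
    \<open>z = 1\<close> the upper bound comes from \<open>eta <= 1\<close>.\<close>
  then have line: "y1 \<le> budget_line z" "budget_line z \<le> 1"
    using box p q by (auto simp: z_def min_def field_simps)
  show "z \<in> line_segment" unfolding line_segment_iff using z line box by auto
  have "cost z (budget_line z) \<le> cost z y1"
    using z line box by (intro cost_antimono_snd) auto
  also have "\<dots> \<le> cost y0 y1"
    using z box \<open>threshold \<le> y1\<close> by (intro cost_antimono_fst) auto
  finally show "cost z (budget_line z) \<le> cost y0 y1" .
qed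

text \<open>The axis value \<open>v\<close> bounds from below all costs under the threshold, and the
  minimum \<open>?c\<close> on the line bounds those at or above it. The position of the line
  minimizer decides which of the two is smaller.\<close>

lemma optimal_pair:
  assumes min: "minimizes_on (\<lambda>x. cost x (budget_line x)) line_segment x0"
  shows "if threshold \<le> budget_line x0
    then optimal p q ps0 ps1 C01 C10 eta (x0, budget_line x0)
    else optimal p q ps0 ps1 C01 C10 eta (0, min 1 (eta * (p + q) / p))"
proof -
  define v where "v = q * C01 / (p + q)"
  let ?c = "cost x0 (budget_line x0)"
  have x0: "x0 \<in> line_segment" using min unfolding minimizes_on_iff by blast
  have above: "?c \<le> cost y0 y1" if "(y0, y1) \<in> feasible p q eta" "threshold \<le> y1" for y0 y1
    using line_dominates_above_threshold[OF that] min
    unfolding minimizes_on_iff by (blast intro: order_trans)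
  have below: "v \<le> cost y0 y1" if "(y0, y1) \<in> feasible p q eta" "y1 < threshold" for y0 y1
    using that cost_below_threshold unfolding v_def by (auto simp: feasible_def)
  have opt: "optimal p q ps0 ps1 C01 C10 eta (z0, z1)"
    if "(z0, z1) \<in> feasible p q eta"
      and "\<And>y0 y1. (y0, y1) \<in> feasible p q eta \<Longrightarrow> cost z0 z1 \<le> cost y0 y1" for z0 z1
    using that unfolding optimal_def is_arg_min_def by (auto simp: not_less)
  have feas: "(x0, budget_line x0) \<in> feasible p q eta"
    using budget_line_feasible x0 .
  show ?thesis
  proof (cases "threshold \<le> budget_line x0")
    case True
    then have "?c \<le> v"
      using feas cost_above_threshold unfolding v_def by (auto simp: feasible_def)
    then have "?c \<le> cost y0 y1" if "(y0, y1) \<in> feasible p q eta" for y0 y1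
      using above[OF that] below[OF that] by (cases "threshold \<le> y1") auto
    with True feas opt show ?thesis by simp
  next
    case False
    let ?m = "min 1 (eta * (p + q) / p)"
    have "0 < ?m" using eta p q by simp
    then have "cost 0 ?m = v" unfolding v_def by (rule cost_axis)
    \<comment> \<open>The line minimizer itself lies below the threshold, so \<open>v\<close> is
      also a lower bound for the costs above it.\<close>
    moreover have "v \<le> ?c" using False feas by (intro below) auto
    ultimately have "cost 0 ?m \<le> cost y0 y1" if "(y0, y1) \<in> feasible p q eta" for y0 y1
      using above[OF that] below[OF that] by (cases "threshold \<le> y1") auto
    moreover have "(0, ?m) \<in> feasible p q eta"
      using \<open>0 < ?m\<close> p q by (auto simp: feasible_def min_def field_simps)
    ultimately show ?thesis using False opt by simp
  qed
qed

end

section \<open>The explicit formulas and the two cases\<close>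

theorem mainTheorem4:
  fixes p q ps0 ps1 C01 C10 delta delta_max eta :: real
    and A1 A2 A3 B1 B2 B3 Delta l0 u0 l1 u1 :: real
    and F G H K :: "real \<Rightarrow> real"
  assumes p: "0 < p" "p \<le> 1" and q: "0 < q" "q \<le> 1"
    and ps0: "0 < ps0" "ps0 \<le> 1" and ps1: "0 < ps1" "ps1 \<le> 1"
    and C01: "0 < C01" and C10: "0 < C10"
    and delta: "0 < delta"
    and eta: "eta = delta_max / delta" "0 < eta" "eta \<le> 1"
    and A1: "A1 = p * q\<^sup>2 * ps0 * ps1 * (C01 + C10)"
    and A2: "A2 = p * q * (C10 * p * ps0 * (1 - eta * ps1) - q * C01 * ps1
                    - q * eta * C10 * ps0 * ps1 - eta * (p + q) * C01 * ps0 * ps1)"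
    and A3: "A3 = p * q * (p + q) * eta * C01 * ps1"
    and B1: "B1 = (p + q) * (p * q * ps0 * ps1 - q * (1 - q) * ps0 * ps1)"
    and B2: "B2 = (p + q) * (p * q * ps0 - p * q * ps1 - eta * p * (p + q) * ps0 * ps1
                    + eta * (1 - q) * (p + q) * ps0 * ps1)"
    and B3: "B3 = eta * p * ps1 * (p + q)\<^sup>2"
    and F: "F = (\<lambda>x. A1 * x\<^sup>2 + A2 * x + A3)"
    and G: "G = (\<lambda>x. B1 * x\<^sup>2 + B2 * x + B3)"
    and Delta: "Delta = (2 * A1 * B3 - 2 * A3 * B1)\<^sup>2
                  - 4 * (A1 * B2 - A2 * B1) * (A2 * B3 - A3 * B2)"
    and l0: "l0 = max 0 ((eta * (p + q) - p) / q)"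
    and u0: "u0 = min 1 (eta * (p + q) / q)"
    and H: "H = (\<lambda>x. p * q * (C10 * ps0 * (1 - x * ps1) * (p * x - eta * (p + q))
                    - C01 * x * ps1 * (q + p * x * ps0 - eta * ps0 * (p + q))))"
    and K: "K = (\<lambda>x. (p + q) * (eta * ps0 * (p + q) * (x * ps1 * (p + q - 1) - q)
                    - p * x * (q * (ps1 - ps0) + ps0 * x * ps1 * (p + q - 1))))"
    and l1: "l1 = max 0 ((eta * (p + q) - q) / p)"
    and u1: "u1 = min 1 (eta * (p + q) / p)"
  shows
    "(p * C10 \<ge> q * C01 \<longrightarrow>
        (\<exists>x0. minimizes_on (\<lambda>x. F x / G x) {l0..u0} x0) \<and>
        (\<forall>x0 x1. minimizes_on (\<lambda>x. F x / G x) {l0..u0} x0 \<and>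
             x1 = (eta * (p + q) - q * x0) / p \<longrightarrow>
           (if x1 \<ge> (p * C10 - q * C01) / (ps1 * (p * C10 + (1 - q) * C01))
            then optimal p q ps0 ps1 C01 C10 eta (x0, x1)
            else optimal p q ps0 ps1 C01 C10 eta (0, min 1 (eta * (p + q) / p)))) \<and>
        (Delta \<ge> 0 \<longrightarrow>
           (\<exists>x. minimizes_on (\<lambda>x. F x / G x) {l0..u0} x \<and>
              (x = l0 \<or> x = u0 \<or>
               x \<in> {l0..u0} \<and>
               (A1 * B2 \<noteq> A2 * B1 \<and>
                  (x = (2 * (A3 * B1 - A1 * B3) + sqrt Delta) / (2 * (A1 * B2 - A2 * B1)) \<or>
                   x = (2 * (A3 * B1 - A1 * B3) - sqrt Delta) / (2 * (A1 * B2 - A2 * B1))) \<or>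
                A1 * B2 = A2 * B1 \<and> A1 * B3 \<noteq> A3 * B1 \<and>
                  x = (A3 * B2 - A2 * B3) / (2 * (A1 * B3 - A3 * B1)))))) \<and>
        (Delta < 0 \<longrightarrow>
           (A1 * B2 > A2 * B1 \<longrightarrow> minimizes_on (\<lambda>x. F x / G x) {l0..u0} l0) \<and>
           (A1 * B2 < A2 * B1 \<longrightarrow> minimizes_on (\<lambda>x. F x / G x) {l0..u0} u0)))
     \<and>
     (p * C10 < q * C01 \<longrightarrow>
        (\<exists>x1. minimizes_on (\<lambda>x. H x / K x) {l1..u1} x1) \<and>
        (\<forall>x0 x1. minimizes_on (\<lambda>x. H x / K x) {l1..u1} x1 \<and>
             x0 = (eta * (p + q) - p * x1) / q \<longrightarrow>
           (if x0 \<ge> (q * C01 - p * C10) / (ps0 * (q * C01 + (1 - p) * C10))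
            then optimal p q ps0 ps1 C01 C10 eta (x0, x1)
            else optimal p q ps0 ps1 C01 C10 eta (min 1 (eta * (p + q) / q), 0))))"
proof (intro conjI impI)
  assume case1: "q * C01 \<le> p * C10"
  interpret status_source_case1 p q ps0 ps1 C01 C10 eta
    using p q ps0 ps1 C01 C10 eta case1 by unfold_locales auto
  have F_eq: "F x = p * (p * q * Psi ps0 ps1 C01 C10 x ((eta * (p + q) - q * x) / p))" for x
  proof -
    define y where "y = (eta * (p + q) - q * x) / p"
    \<comment> \<open>This linear relation replaces the division in \<open>y\<close>, so the
      identity becomes polynomial. The extra factor \<open>p\<close> in \<open>F\<close> and
      \<open>G\<close> clears that denominator and cancels in \<open>F / G\<close>.\<close>
    have "p * y + q * x = eta * (p + q)" using p by (simp add: y_def)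
    then show ?thesis unfolding F A1 A2 A3 Psi_def y_def[symmetric] by algebra
  qed
  have G_eq: "G x = p * ((p + q) * Phi p q ps0 ps1 x ((eta * (p + q) - q * x) / p))" for x
  proof -
    define y where "y = (eta * (p + q) - q * x) / p"
    have "p * y + q * x = eta * (p + q)" using p by (simp add: y_def)
    then show ?thesis unfolding G B1 B2 B3 Phi_def y_def[symmetric] by algebra
  qed
  have FG: "F x / G x = PEC p q ps0 ps1 C01 C10 x ((eta * (p + q) - q * x) / p)" for x
    using p unfolding F_eq G_eq PEC_def by simp
  interpret quadratic_quotient A1 A2 A3 B1 B2 B3 l0 u0 F G
    rewrites "quadratic_quotient.Delta A1 A2 A3 B1 B2 B3 = Delta"
  proof -
    show "quadratic_quotient A1 A2 A3 B1 B2 B3 l0 u0 F G"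
    proof
      show "l0 \<le> u0" unfolding l0 u0 by (rule line_segment_nonempty)
      show "0 < G x" if "x \<in> {l0..u0}" for x
        using that Phi_line_pos[of x] p q unfolding l0 u0 G_eq by simp
    qed (fact F G)+
    then show "quadratic_quotient.Delta A1 A2 A3 B1 B2 B3 = Delta"
      unfolding Delta by (rule quadratic_quotient.Delta_def)
  qed
  show "\<exists>x0. minimizes_on (\<lambda>x. F x / G x) {l0..u0} x0"
    by (rule quotient_minimum_exists)
  show "\<forall>x0 x1. minimizes_on (\<lambda>x. F x / G x) {l0..u0} x0 \<and>
             x1 = (eta * (p + q) - q * x0) / p \<longrightarrow>
           (if x1 \<ge> (p * C10 - q * C01) / (ps1 * (p * C10 + (1 - q) * C01))
            then optimal p q ps0 ps1 C01 C10 eta (x0, x1)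
            else optimal p q ps0 ps1 C01 C10 eta (0, min 1 (eta * (p + q) / p)))"
    using optimal_pair unfolding threshold_def FG l0 u0 by blast
  show "\<exists>x. minimizes_on (\<lambda>x. F x / G x) {l0..u0} x \<and>
              (x = l0 \<or> x = u0 \<or>
               x \<in> {l0..u0} \<and>
               (A1 * B2 \<noteq> A2 * B1 \<and>
                  (x = (2 * (A3 * B1 - A1 * B3) + sqrt Delta) / (2 * (A1 * B2 - A2 * B1)) \<or>
                   x = (2 * (A3 * B1 - A1 * B3) - sqrt Delta) / (2 * (A1 * B2 - A2 * B1))) \<or>
                A1 * B2 = A2 * B1 \<and> A1 * B3 \<noteq> A3 * B1 \<and>
                  x = (A3 * B2 - A2 * B3) / (2 * (A1 * B3 - A3 * B1))))"
    if "Delta \<ge> 0"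
    using that by (rule minimum_nonneg_discriminant)
  show "minimizes_on (\<lambda>x. F x / G x) {l0..u0} l0" if "Delta < 0" "A1 * B2 > A2 * B1"
    using that by (rule minimum_negative_discriminant)
  show "minimizes_on (\<lambda>x. F x / G x) {l0..u0} u0" if "Delta < 0" "A1 * B2 < A2 * B1"
    using that by (rule minimum_negative_discriminant)
next
  assume case2: "p * C10 < q * C01"
  \<comment> \<open>Exchanging the states swaps \<open>p\<close> with \<open>q\<close>,
    \<open>ps0\<close> with \<open>ps1\<close> and \<open>C01\<close> with \<open>C10\<close>, which
    turns \<open>case2\<close> into the hypothesis of Case 1.\<close>
  interpret swap: status_source_case1 q p ps1 ps0 C10 C01 eta
    using p q ps0 ps1 C01 C10 eta case2 by unfold_locales auto
  \<comment> \<open>\<open>H\<close> and \<open>K\<close> both carry the factor \<open>- q\<close>;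
    the signs cancel in the quotient, although \<open>K\<close> is negative on the segment.\<close>
  have H_eq: "H x = - q * (q * p * Psi ps1 ps0 C10 C01 x ((eta * (q + p) - p * x) / q))" for x
  proof -
    define y where "y = (eta * (q + p) - p * x) / q"
    have "q * y + p * x = eta * (q + p)" using q by (simp add: y_def)
    then show ?thesis unfolding H Psi_def y_def[symmetric] by algebra
  qed
  have K_eq: "K x = - q * ((q + p) * Phi q p ps1 ps0 x ((eta * (q + p) - p * x) / q))" for x
  proof -
    define y where "y = (eta * (q + p) - p * x) / q"
    have "q * y + p * x = eta * (q + p)" using q by (simp add: y_def)
    then show ?thesis unfolding K Phi_def y_def[symmetric] by algebra
  qed
  have HK: "H x / K x = PEC q p ps1 ps0 C10 C01 x ((eta * (q + p) - p * x) / q)" for x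
    using q unfolding H_eq K_eq PEC_def by simp
  have seg: "{l1..u1} = {max 0 ((eta * (q + p) - q) / p) .. min 1 (eta * (q + p) / p)}"
    unfolding l1 u1 by (simp add: add.commute)
  show "\<exists>x1. minimizes_on (\<lambda>x. H x / K x) {l1..u1} x1"
    unfolding seg
  \<comment> \<open>Only existence is claimed here, so continuity on a compact interval suffices and
    no critical points are computed.\<close>
  proof (rule minimizes_on_exists[OF swap.line_segment_nonempty], intro continuous_intros ballI)
    show "continuous_on S H" for S unfolding H by (intro continuous_intros)
    show "continuous_on S K" for S unfolding K by (intro continuous_intros)
    show "K x \<noteq> 0" if "x \<in> swap.line_segment" for x
      using swap.Phi_line_pos[OF that] p q by (simp add: K_eq)
  qed
  show "\<forall>x0 x1. minimizes_on (\<lambda>x. H x / K x) {l1..u1} x1 \<and>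
             x0 = (eta * (p + q) - p * x1) / q \<longrightarrow>
           (if x0 \<ge> (q * C01 - p * C10) / (ps0 * (q * C01 + (1 - p) * C10))
            then optimal p q ps0 ps1 C01 C10 eta (x0, x1)
            else optimal p q ps0 ps1 C01 C10 eta (min 1 (eta * (p + q) / q), 0))"
    \<comment> \<open>Swapping the coordinates back turns the fallback point on the axis
      \<open>x0 = 0\<close> into the one on \<open>x1 = 0\<close>.\<close>
    using swap.optimal_pair
    unfolding swap.threshold_def HK seg optimal_swap[of p] add.commute[of p q] by blast
qed

end
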